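(* Let $s\subseteq N$ with $\Delta(s)\ge0$ and $V(\{i\})\ge0$ for all $i\in s$, let $g\in G$, and take $M_s=V(s)$. Then at every point of the box $z_{ig}\in[0,1]$, $i\in s$, the right-hand side of the lifted stability cut $$\sum_{i\in s}v_i\ \ge\ \Delta(s)\Bigl(\sum_{i\in s}z_{ig}-|s|+1\Bigr)+\sum_{i\in s}V(\{i\})\,z_{ig}\qquad(L)$$ is at least the right-hand side of the stability inequality $$\sum_{i\in s}v_i\ \ge\ V(s)-M_s\Bigl(|s|-\sum_{i\in s}z_{ig}\Bigr).\qquad(B)$$ Consequently $(L)$ implies $(B)$ as a constraint on $(v,z)$.
   Context: $N$ is a finite player set, $V:2^N\to\mathbb R$ with $V(\emptyset)=0$ is the characteristic function of a cooperative game, and $G:=N$ indexes groups. The variables are payoffs $v_i$ ($i\in N$) and assignment variables $z_{ig}$ ($i\in N$, $g\in G$) with $z_{ig}\in[0,1]$. The synergy of $s$ is $\Delta(s):=V(s)-\sum_{i\in s}V(\{i\})$. *)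

theory Defs
  imports Complex_Main
begin

text \<open>
  A cooperative game on a finite player set \<open>N\<close> is given by \<open>V :: 'a set \<Rightarrow> real\<close>; only
  its values on subsets of \<open>N\<close> matter. Groups are indexed by the players themselves,
  and \<open>z i g\<close> is the assignment variable of player \<open>i\<close> to group \<open>g\<close>.
\<close>

definition coop_game :: "'a set \<Rightarrow> ('a set \<Rightarrow> real) \<Rightarrow> bool" where
  "coop_game N V \<longleftrightarrow> finite N \<and> V {} = 0"

definition synergy :: "('a set \<Rightarrow> real) \<Rightarrow> 'a set \<Rightarrow> real" where
  "synergy V s = V s - (\<Sum>i\<in>s. V {i})"

definition lifted_rhs ::
  "('a set \<Rightarrow> real) \<Rightarrow> 'a set \<Rightarrow> 'a \<Rightarrow> ('a \<Rightarrow> 'a \<Rightarrow> real) \<Rightarrow> real" where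
  "lifted_rhs V s g z =
     synergy V s * ((\<Sum>i\<in>s. z i g) - real (card s) + 1) + (\<Sum>i\<in>s. V {i} * z i g)"

definition stability_rhs ::
  "('a set \<Rightarrow> real) \<Rightarrow> ('a set \<Rightarrow> real) \<Rightarrow> 'a set \<Rightarrow> 'a \<Rightarrow> ('a \<Rightarrow> 'a \<Rightarrow> real) \<Rightarrow> real" where
  "stability_rhs V M s g z = V s - M s * (real (card s) - (\<Sum>i\<in>s. z i g))"

definition lifted_stability_cut ::
  "('a set \<Rightarrow> real) \<Rightarrow> 'a set \<Rightarrow> 'a \<Rightarrow> ('a \<Rightarrow> real) \<Rightarrow> ('a \<Rightarrow> 'a \<Rightarrow> real) \<Rightarrow> bool" where
  "lifted_stability_cut V s g v z \<longleftrightarrow> (\<Sum>i\<in>s. v i) \<ge> lifted_rhs V s g z"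

definition stability_inequality ::
  "('a set \<Rightarrow> real) \<Rightarrow> ('a set \<Rightarrow> real) \<Rightarrow> 'a set \<Rightarrow> 'a \<Rightarrow> ('a \<Rightarrow> real) \<Rightarrow> ('a \<Rightarrow> 'a \<Rightarrow> real) \<Rightarrow> bool" where
  "stability_inequality V M s g v z \<longleftrightarrow> (\<Sum>i\<in>s. v i) \<ge> stability_rhs V M s g z"

end

theory Submission imports Defs begin

text \<open>
  Put \<open>k = |s| - (\<Sum>i\<in>s. z i g)\<close>. The synergy terms cancel in the difference of the two right-hand
  sides, which equals \<open>\<Sum>i\<in>s. V {i} * (k - (1 - z i g))\<close>. Each summand is nonnegative, because
  \<open>k\<close> is the sum of the nonnegative slacks \<open>1 - z j g\<close> and so dominates each of them.
\<close>

text \<open>With \<open>M s = V s\<close> the stability side factors as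
  \<open>V s * (1 - k)\<close>. Subtracting it from \<open>synergy V s * (1 - k)\<close> leaves
  \<open>- (1 - k)\<close> times the sum of the singleton values, which merges termwise with
  \<open>V {i} * z i g\<close>.\<close>

lemma lifted_rhs_minus_stability_rhs:
  assumes "M s = V s"
  shows "lifted_rhs V s g z - stability_rhs V M s g z =
    (\<Sum>i\<in>s. V {i} * ((\<Sum>j\<in>s. 1 - z j g) - (1 - z i g)))"
  using assms unfolding lifted_rhs_def stability_rhs_def synergy_def
  by (simp add: sum_subtractf sum.distrib algebra_simps
      sum_distrib_left[symmetric] sum_distrib_right[symmetric])

lemma stability_rhs_le_lifted_rhs:
  assumes "finite s" and "\<forall>i\<in>s. V {i} \<ge> 0" and "M s = V s" and "\<forall>i\<in>s. z i g \<in> {0..1}"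
  shows "stability_rhs V M s g z \<le> lifted_rhs V s g z"
proof -
  have "1 - z i g \<le> (\<Sum>j\<in>s. 1 - z j g)" if "i \<in> s" for i
    \<comment> \<open>The box bound \<open>z j g \<le> 1\<close> makes the other slacks
      nonnegative.\<close>
    by (rule member_le_sum[OF that]) (use assms in auto)
  with assms(2) have "0 \<le> (\<Sum>i\<in>s. V {i} * ((\<Sum>j\<in>s. 1 - z j g) - (1 - z i g)))"
    by (intro sum_nonneg mult_nonneg_nonneg) auto
  with lifted_rhs_minus_stability_rhs[of M s V g z] assms(3) show ?thesis
    by linarith
qed

theorem proposition6:
  fixes N G :: "'a set" and V M :: "'a set \<Rightarrow> real" and s :: "'a set" and g :: 'a
  assumes "coop_game N V"
    and "G = N"
    and "s \<subseteq> N"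
    and "synergy V s \<ge> 0"
    and "\<forall>i\<in>s. V {i} \<ge> 0"
    and "g \<in> G"
    and "M s = V s"
  shows "(\<forall>z. (\<forall>i\<in>s. z i g \<in> {0..1}) \<longrightarrow> lifted_rhs V s g z \<ge> stability_rhs V M s g z) \<and>
         (\<forall>v z. (\<forall>i\<in>s. z i g \<in> {0..1}) \<longrightarrow>
            lifted_stability_cut V s g v z \<longrightarrow> stability_inequality V M s g v z)"
proof -
  have "finite s"
    using assms(1,3) finite_subset by (auto simp: coop_game_def)
  then have "stability_rhs V M s g z \<le> lifted_rhs V s g z" if "\<forall>i\<in>s. z i g \<in> {0..1}" for z
    using assms(5,7) that by (rule stability_rhs_le_lifted_rhs)
  \<comment> \<open>The implication between the constraints is transitivity through
    \<open>lifted_rhs V s g z\<close>, at the same \<open>z\<close>.\<close>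
  then show ?thesis
    unfolding lifted_stability_cut_def stability_inequality_def
    using order_trans by blast
qed

end
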